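(* Let $r\ge 2$ be an integer. Then $FS_r$ has (two-sided) ideal growth of strict type $2^n=n^{n/\log(n)}$; that is, $\log(s_n^I(FS_r))\asymp \log(2^n)$ as $n\to\infty$.
   Context: $FS_r$ is the free semigroup of rank $r$, i.e. all non-empty words over an alphabet of $r$ letters under concatenation. The (Rees) index of a subset $T\subseteq S$ is $|S\setminus T|$. A (two-sided) ideal $I$ of a semigroup $S$ is a subsemigroup with $SI\subseteq I$ and $IS\subseteq I$. $a_n^I(FS_r)$ denotes the number of two-sided ideals of $FS_r$ of Rees index exactly $n$, and $s_n^I(FS_r)=\sum_{i=1}^n a_i^I(FS_r)$. For sequences, $f(n)=O(g(n))$ means there is a constant $C>0$ with $f(n)\le C\,g(n)$ for all large $n$, and $f(n)\asymp g(n)$ means $f(n)=O(g(n))$ and $g(n)=O(f(n))$. $\log$ is base $2$. *)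

theory Defs
  imports Complex_Main "HOL-Library.Landau_Symbols"
begin

text \<open>Semigroups are represented by a carrier set \<open>S\<close> and an operation \<open>f\<close>.
  The empty set is admitted as a subsemigroup and as an ideal; in an infinite semigroup it has
  infinite Rees index, so it does not affect the counting functions below.\<close>

definition subsemigroup :: "'a set \<Rightarrow> ('a \<Rightarrow> 'a \<Rightarrow> 'a) \<Rightarrow> 'a set \<Rightarrow> bool" where
  "subsemigroup S f T \<longleftrightarrow> T \<subseteq> S \<and> (\<forall>x\<in>T. \<forall>y\<in>T. f x y \<in> T)"

definition semigroup_ideal :: "'a set \<Rightarrow> ('a \<Rightarrow> 'a \<Rightarrow> 'a) \<Rightarrow> 'a set \<Rightarrow> bool" where
  "semigroup_ideal S f I \<longleftrightarrow>
     subsemigroup S f I \<and> (\<forall>s\<in>S. \<forall>x\<in>I. f s x \<in> I) \<and> (\<forall>x\<in>I. \<forall>s\<in>S. f x s \<in> I)"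

text \<open>The finiteness condition matters only for \<open>n = 0\<close>, since infinite sets have
  cardinality \<open>0\<close>.\<close>

definition has_Rees_index :: "'a set \<Rightarrow> 'a set \<Rightarrow> nat \<Rightarrow> bool" where
  "has_Rees_index S T n \<longleftrightarrow> finite (S - T) \<and> card (S - T) = n"

definition num_ideals :: "'a set \<Rightarrow> ('a \<Rightarrow> 'a \<Rightarrow> 'a) \<Rightarrow> nat \<Rightarrow> nat" where
  "num_ideals S f n = card {I. semigroup_ideal S f I \<and> has_Rees_index S I n}"

definition ideal_growth :: "'a set \<Rightarrow> ('a \<Rightarrow> 'a \<Rightarrow> 'a) \<Rightarrow> nat \<Rightarrow> nat" where
  "ideal_growth S f n = (\<Sum>i=1..n. num_ideals S f i)"

definition ideal_growth_strict_type ::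
    "'a set \<Rightarrow> ('a \<Rightarrow> 'a \<Rightarrow> 'a) \<Rightarrow> (nat \<Rightarrow> real) \<Rightarrow> bool" where
  "ideal_growth_strict_type S f g \<longleftrightarrow>
     (\<lambda>n. log 2 (real (ideal_growth S f n))) \<in> \<Theta>(\<lambda>n. log 2 (g n))"

text \<open>The free semigroup of rank \<open>r\<close>, with concatenation \<open>(@)\<close> as its operation.\<close>

definition free_semigroup :: "nat \<Rightarrow> nat list set" where
  "free_semigroup r = {w. w \<noteq> [] \<and> set w \<subseteq> {..<r}}"

end

theory Submission
  imports Defs "HOL-Library.FuncSet"
begin

text \<open>The complement of an ideal is a set of words closed under nonempty factors; adding the
  empty word makes it prefix-closed, that is, a rooted subtree of the \<open>r\<close>-ary tree. For the
  subtrees \<open>T\<close> of any bounded depth, \<open>\<Sum>T. x ^ card T\<close> obeys the recursion \<open>W \<mapsto> 1 + x * W ^ r\<close>,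
  which for \<open>x = 2 ^ (- r)\<close> preserves the bound \<open>W \<le> 2\<close>; hence there are at most
  \<open>2 * 2 ^ (r * m)\<close> subtrees with at most \<open>m\<close> nodes. Conversely, all nonempty binary words of
  length below \<open>k\<close> together with an arbitrary set of binary words of length \<open>k\<close> form the
  complement of an ideal, which gives \<open>2 ^ (2 ^ k)\<close> ideals of index below \<open>2 ^ (k + 1)\<close>.\<close>

section \<open>Counting subtrees of the \<open>r\<close>-ary tree\<close>

definition prefix_closed :: "'a list set \<Rightarrow> bool" where
  "prefix_closed T \<longleftrightarrow> (\<forall>u v. u @ v \<in> T \<longrightarrow> u \<in> T)"

text \<open>The empty set belongs to this family, so a missing branch needs no separate case. The
  bound \<open>d\<close> on the number of levels makes the family finite and carries the
  induction.\<close>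

definition subtrees :: "nat \<Rightarrow> nat \<Rightarrow> nat list set set" where
  "subtrees r d = {T. prefix_closed T \<and> T \<subseteq> {w. set w \<subseteq> {..<r} \<and> length w < d}}"

definition join_subtrees :: "nat \<Rightarrow> (nat \<Rightarrow> nat list set) \<Rightarrow> nat list set" where
  "join_subtrees r g = insert [] (\<Union>a<r. (#) a ` g a)"

lemma finite_words_length_less: "finite {w. set w \<subseteq> {..<r::nat} \<and> length w < d}"
  by (rule finite_subset[OF _ finite_lists_length_le[of "{..<r}" d]]) auto

lemma finite_subtrees: "finite (subtrees r d)"
  unfolding subtrees_def
  by (rule finite_subset[OF _ finite_Pow_iff[THEN iffD2, OF finite_words_length_less[of r d]]]) auto

lemma finite_in_subtrees: "T \<in> subtrees r d \<Longrightarrow> finite T"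
  unfolding subtrees_def using finite_subset[OF _ finite_words_length_less[of r d]] by auto

lemma card_join_subtrees:
  assumes "\<And>a. a < r \<Longrightarrow> finite (g a)"
  shows "card (join_subtrees r g) = Suc (\<Sum>a<r. card (g a))"
proof -
  have "card (\<Union>a<r. (#) a ` g a) = (\<Sum>a<r. card ((#) a ` g a))"
    using assms by (intro card_UN_disjoint) auto
  also have "\<dots> = (\<Sum>a<r. card (g a))"
    by (intro sum.cong refl card_image) auto
  finally show ?thesis
    unfolding join_subtrees_def using assms by (subst card_insert_disjoint) auto
qed

text \<open>A nonempty tree contains its root \<open>[]\<close> and is recovered by joining its
  branches \<open>{w. a # w \<in> T}\<close>, each of which has one level less. An inclusion
  suffices for an upper bound.\<close>

lemma subtrees_Suc_subset:
  "subtrees r (Suc d) \<subseteq> insert {} (join_subtrees r ` ({..<r} \<rightarrow>\<^sub>E subtrees r d))"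
proof
  fix T assume T: "T \<in> subtrees r (Suc d)"
  define g where "g = (\<lambda>a\<in>{..<r}. {w. a # w \<in> T})"
  have "prefix_closed {w. a # w \<in> T}" for a
    using T unfolding subtrees_def prefix_closed_def by (auto simp flip: append_Cons)
  then have "g \<in> {..<r} \<rightarrow>\<^sub>E subtrees r d"
    using T unfolding g_def subtrees_def by fastforce
  moreover have "T = join_subtrees r g" if "T \<noteq> {}"
  proof -
    have "[] \<in> T"
      using T that unfolding subtrees_def prefix_closed_def by (metis (lifting) append_Nil equals0I mem_Collect_eq)
    moreover have "w \<in> join_subtrees r g" if "w \<in> T" for w
    proof (cases w)
      case (Cons a v)
      then have "a < r" "v \<in> g a"
        using that T by (auto simp: subtrees_def g_def)
      then show ?thesis
        unfolding Cons join_subtrees_def by blast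
    qed (simp add: join_subtrees_def)
    ultimately show ?thesis
      by (auto simp: join_subtrees_def g_def)
  qed
  ultimately show "T \<in> insert {} (join_subtrees r ` ({..<r} \<rightarrow>\<^sub>E subtrees r d))"
    by blast
qed

lemma sum_subtrees_le_2: "(\<Sum>T\<in>subtrees r d. (1 / 2 ^ r :: real) ^ card T) \<le> 2"
proof (induction d)
  case 0
  have "subtrees r 0 = {{}}"
    by (auto simp: subtrees_def prefix_closed_def)
  then show ?case by simp
next
  case (Suc d)
  define x :: real where "x = 1 / 2 ^ r"
  define P where "P = ({..<r} \<rightarrow>\<^sub>E subtrees r d)"
  have x: "x \<ge> 0" by (simp add: x_def)
  have P: "finite P"
    unfolding P_def by (intro finite_PiE finite_subtrees) auto
  have "(\<Sum>T\<in>subtrees r (Suc d). x ^ card T) \<le> (\<Sum>T\<in>insert {} (join_subtrees r ` P). x ^ card T)"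
    using subtrees_Suc_subset[of r d] P x unfolding P_def by (intro sum_mono2) auto
  also have "\<dots> = 1 + (\<Sum>T\<in>join_subtrees r ` P. x ^ card T)"
    using P by (subst sum.insert) (auto simp: join_subtrees_def)
  \<comment> \<open>Since the weights are nonnegative, collapsing an index set to its image can only
    decrease the sum.\<close>
  also have "(\<Sum>T\<in>join_subtrees r ` P. x ^ card T) \<le> (\<Sum>g\<in>P. x ^ card (join_subtrees r g))"
    using sum_image_le[OF P, of "\<lambda>T. x ^ card T" "join_subtrees r"] x by (simp add: o_def)
  also have "\<dots> = (\<Sum>g\<in>P. x * (\<Prod>a<r. x ^ card (g a)))"
  proof (intro sum.cong refl)
    fix g assume "g \<in> P"
    then have "card (join_subtrees r g) = Suc (\<Sum>a<r. card (g a))"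
      by (intro card_join_subtrees finite_in_subtrees[of _ r d]) (auto simp: P_def)
    then show "x ^ card (join_subtrees r g) = x * (\<Prod>a<r. x ^ card (g a))"
      by (simp add: power_sum)
  qed
  \<comment> \<open>A function in \<open>P\<close> chooses the branch at each letter independently,
    so the sum over \<open>P\<close> of products factors into a product of \<open>r\<close> equal
    sums.\<close>
  also have "\<dots> = x * (\<Prod>a<r. \<Sum>T\<in>subtrees r d. x ^ card T)"
    unfolding P_def by (subst prod_sum_PiE) (auto simp: finite_subtrees sum_distrib_left)
  also have "\<dots> \<le> x * (\<Prod>a<r. 2)"
    using Suc x unfolding x_def by (intro mult_left_mono prod_mono) (auto intro!: sum_nonneg)
  also have "\<dots> = 1" by (simp add: x_def)
  finally show ?case by (simp add: x_def)
qed

text \<open>A Markov-type estimate: as \<open>1 / 2 ^ r\<close> is at most 1, each counted tree has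
  weight at least \<open>(1 / 2 ^ r) ^ m\<close>, while the total weight is at most 2.\<close>

lemma card_subtrees_le: "card {T \<in> subtrees r d. card T \<le> m} \<le> 2 * 2 ^ (r * m)"
proof -
  let ?A = "{T \<in> subtrees r d. card T \<le> m}"
  have "real (card ?A) * (1 / 2 ^ r) ^ m = (\<Sum>T\<in>?A. (1 / 2 ^ r :: real) ^ m)"
    by simp
  also have "\<dots> \<le> (\<Sum>T\<in>?A. (1 / 2 ^ r :: real) ^ card T)"
    by (intro sum_mono power_decreasing) auto
  also have "\<dots> \<le> (\<Sum>T\<in>subtrees r d. (1 / 2 ^ r :: real) ^ card T)"
    by (intro sum_mono2 finite_subtrees) auto
  also have "\<dots> \<le> 2"
    by (rule sum_subtrees_le_2)
  finally have "real (card ?A) \<le> 2 * 2 ^ (r * m)"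
    by (simp add: field_simps flip: power_mult)
  then have "real (card ?A) \<le> real (2 * 2 ^ (r * m))"
    by simp
  then show ?thesis
    by (simp only: of_nat_le_iff)
qed

text \<open>The \<open>length w + 1\<close> prefixes of \<open>w\<close> are distinct members of
  \<open>T\<close>. This turns a bound on the size of a tree into a bound on its depth.\<close>

lemma length_less_card_prefix_closed:
  assumes "prefix_closed T" "finite T" "w \<in> T"
  shows "length w < card T"
proof -
  have "(\<lambda>i. take i w) ` {..length w} \<subseteq> T"
    using assms unfolding prefix_closed_def by (metis append_take_drop_id image_subsetI)
  moreover have "inj_on (\<lambda>i. take i w) {..length w}"
    by (rule inj_onI) (metis atMost_iff length_take min.absorb2)
  ultimately have "card {..length w} \<le> card T"
    using assms(2) by (metis card_image card_mono)
  then show ?thesis by simp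
qed

section \<open>Upper bound: ideals as trees\<close>

definition ideals_index_upto :: "'a set \<Rightarrow> ('a \<Rightarrow> 'a \<Rightarrow> 'a) \<Rightarrow> nat \<Rightarrow> 'a set set" where
  "ideals_index_upto S f n =
     {I. semigroup_ideal S f I \<and> finite (S - I) \<and> card (S - I) \<in> {1..n}}"

text \<open>If a nonempty \<open>u\<close> lay in \<open>I\<close>, so would \<open>u @ v\<close>;
  hence the complement of \<open>I\<close> together with \<open>[]\<close> is prefix-closed. It has
  at most \<open>Suc n\<close> nodes, the extra one being \<open>[]\<close>, and it determines
  \<open>I\<close>.\<close>

lemma ideals_index_upto_free_semigroup:
  "finite (ideals_index_upto (free_semigroup r) (@) n)"
  "card (ideals_index_upto (free_semigroup r) (@) n) \<le> 2 * 2 ^ (r * Suc n)"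
proof -
  let ?A = "ideals_index_upto (free_semigroup r) (@) n"
  let ?B = "{T \<in> subtrees r (Suc n). card T \<le> Suc n}"
  let ?h = "\<lambda>I. insert [] (free_semigroup r - I)"
  have inj: "inj_on ?h ?A"
  proof (rule inj_onI)
    fix I J assume IJ: "I \<in> ?A" "J \<in> ?A" "?h I = ?h J"
    have "I \<subseteq> free_semigroup r" "J \<subseteq> free_semigroup r"
      using IJ by (auto simp: ideals_index_upto_def semigroup_ideal_def subsemigroup_def)
    moreover have "[] \<notin> free_semigroup r"
      by (simp add: free_semigroup_def)
    ultimately show "I = J"
      using IJ(3) by (metis DiffD1 Diff_Diff_Int Int_absorb1 insert_ident)
  qed
  have sub: "?h ` ?A \<subseteq> ?B"
  proof (rule image_subsetI)
    fix I assume I: "I \<in> ?A"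
    then have fin: "finite (?h I)" and card: "card (?h I) \<le> Suc n"
      by (auto simp: ideals_index_upto_def card_insert_if)
    have id: "u @ v \<in> I" if "u \<in> I" "v \<in> free_semigroup r" for u v
      using I that by (auto simp: ideals_index_upto_def semigroup_ideal_def)
    have "prefix_closed (?h I)"
      unfolding prefix_closed_def
    proof (intro allI impI)
      fix u v assume uv: "u @ v \<in> ?h I"
      show "u \<in> ?h I"
      proof (cases "u = [] \<or> v = []")
        case False
        then have "u \<in> free_semigroup r" "v \<in> free_semigroup r"
          using uv by (auto simp: free_semigroup_def)
        then show ?thesis using uv id[of u v] False by auto
      qed (use uv in auto)
    qed
    moreover from length_less_card_prefix_closed[OF this fin] card
    have "length w < Suc n" if "w \<in> ?h I" for w
      using that by (meson less_le_trans)
    then have "?h I \<subseteq> {w. set w \<subseteq> {..<r} \<and> length w < Suc n}"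
      by (auto simp: free_semigroup_def)
    ultimately show "?h I \<in> ?B"
      using card by (simp add: subtrees_def)
  qed
  have finB: "finite ?B"
    using finite_subtrees by simp
  show "finite ?A"
    using inj_on_finite[OF inj sub finB] .
  show "card ?A \<le> 2 * 2 ^ (r * Suc n)"
    using card_inj_on_le[OF inj sub finB] card_subtrees_le by (rule order.trans)
qed

lemma ideal_growth_eq_card:
  assumes "finite (ideals_index_upto S f n)"
  shows "ideal_growth S f n = card (ideals_index_upto S f n)"
proof -
  let ?A = "\<lambda>i. {I. semigroup_ideal S f I \<and> has_Rees_index S I i}"
  have eq: "ideals_index_upto S f n = (\<Union>i\<in>{1..n}. ?A i)"
    by (auto simp: ideals_index_upto_def has_Rees_index_def)
  have "card (\<Union>i\<in>{1..n}. ?A i) = (\<Sum>i=1..n. card (?A i))"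
  proof (intro card_UN_disjoint ballI)
    fix i assume "i \<in> {1..n}"
    then have "?A i \<subseteq> ideals_index_upto S f n"
      unfolding eq by blast
    then show "finite (?A i)"
      using assms by (rule finite_subset)
  qed (auto simp: has_Rees_index_def)
  then show ?thesis
    by (simp add: eq ideal_growth_def num_ideals_def)
qed

section \<open>Lower bound: arbitrary top layers of binary words\<close>

lemma binary_layer_complement_ideal:
  assumes r: "r \<ge> 2" and k: "k \<ge> 2" and n: "2 ^ Suc k \<le> n"
    and X: "X \<subseteq> {w. set w \<subseteq> {..<2} \<and> length w = k}"
    and F: "F = {w. w \<noteq> [] \<and> set w \<subseteq> {..<2} \<and> length w < k} \<union> X"
  shows "free_semigroup r - F \<in> ideals_index_upto (free_semigroup r) (@) n"
proof -
  have words: "F \<subseteq> {w. set w \<subseteq> {..<2} \<and> length w \<le> k}"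
    using X by (auto simp: F)
  \<comment> \<open>A proper factor of a word in \<open>F\<close> is shorter than \<open>k\<close>,
    and all nonempty binary words that short lie in \<open>F\<close>, whatever \<open>X\<close>
    is.\<close>
  have factor: "v \<in> F" if "u @ v @ w \<in> F" "v \<noteq> []" "u \<noteq> [] \<or> w \<noteq> []" for u v w
  proof -
    have "set (u @ v @ w) \<subseteq> {..<2}" "length (u @ v @ w) \<le> k"
      using that words by blast+
    then show ?thesis using that by (cases u; cases w) (auto simp: F)
  qed
  have avoid: "s @ x \<notin> F \<and> x @ s \<notin> F" if "x \<notin> F" "x \<noteq> []" "s \<noteq> []" for s x
    using that factor[of s x "[]"] factor[of "[]" x s] by auto
  have fin: "finite {w. set w \<subseteq> {..<2::nat} \<and> length w \<le> k}"
    by (rule finite_lists_length_le) simp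
  have FS: "F \<subseteq> free_semigroup r"
    using X k r by (fastforce simp: F free_semigroup_def)
  then have compl: "free_semigroup r - (free_semigroup r - F) = F"
    by blast
  have "card F \<le> card {w. set w \<subseteq> {..<2::nat} \<and> length w \<le> k}"
    by (rule card_mono[OF fin words])
  also have "\<dots> = (\<Sum>i\<le>k. 2 ^ i)"
    by (subst card_lists_length_le) auto
  also have "\<dots> < 2 ^ Suc k"
    by (induction k) auto
  finally have "card F \<le> n" using n by simp
  moreover have "finite F"
    using finite_subset[OF words fin] .
  \<comment> \<open>The growth function sums from index 1, so \<open>F\<close> has to be
    nonempty.\<close>
  moreover have "[0] \<in> F"
    using k by (simp add: F)
  ultimately have "card F \<in> {1..n}"
    by (auto simp: Suc_le_eq card_gt_0_iff)
  moreover have "semigroup_ideal (free_semigroup r) (@) (free_semigroup r - F)"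
    unfolding semigroup_ideal_def subsemigroup_def using avoid
    by (simp add: free_semigroup_def)
  ultimately show ?thesis
    using \<open>finite F\<close> by (simp add: ideals_index_upto_def compl)
qed

text \<open>There are \<open>2 ^ k\<close> binary words of length \<open>k\<close>, and the ideal
  determines the chosen subset \<open>X\<close> because \<open>X\<close> is disjoint from the
  shorter layers.\<close>

lemma ideal_growth_free_semigroup_ge:
  assumes r: "r \<ge> 2" and k: "k \<ge> 2" and n: "2 ^ Suc k \<le> n"
  shows "2 ^ (2 ^ k) \<le> ideal_growth (free_semigroup r) (@) n"
proof -
  let ?W = "{w. set w \<subseteq> {..<2::nat} \<and> length w = k}"
  let ?L = "{w. w \<noteq> [] \<and> set w \<subseteq> {..<2::nat} \<and> length w < k}"
  let ?h = "\<lambda>X. free_semigroup r - (?L \<union> X)"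
  have "inj_on ?h (Pow ?W)"
  proof (rule inj_onI)
    fix X Y assume XY: "X \<in> Pow ?W" "Y \<in> Pow ?W" "?h X = ?h Y"
    have "?W \<subseteq> free_semigroup r" "?W \<inter> ?L = {}"
      using k r by (fastforce simp: free_semigroup_def)+
    with XY show "X = Y" by blast
  qed
  moreover have "?h ` Pow ?W \<subseteq> ideals_index_upto (free_semigroup r) (@) n"
    using binary_layer_complement_ideal[OF r k n _ refl] by blast
  ultimately have "card (Pow ?W) \<le> card (ideals_index_upto (free_semigroup r) (@) n)"
    by (rule card_inj_on_le) (rule ideals_index_upto_free_semigroup)
  moreover have "card (Pow ?W) = 2 ^ (2 ^ k)"
    by (subst card_Pow) (auto simp: finite_lists_length_eq card_lists_length_eq)
  ultimately show ?thesis
    by (simp add: ideal_growth_eq_card ideals_index_upto_free_semigroup)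
qed

section \<open>Linear bounds on the logarithm and the growth type\<close>

lemma log_ideal_growth_free_semigroup_bounds:
  assumes r: "r \<ge> 2" and n: "n \<ge> 8"
  shows "real n / 4 \<le> log 2 (real (ideal_growth (free_semigroup r) (@) n))"
    and "log 2 (real (ideal_growth (free_semigroup r) (@) n)) \<le> real (2 * r + 1) * real n"
proof -
  let ?s = "ideal_growth (free_semigroup r) (@) n"
  obtain m where m: "2 ^ m \<le> n" "n < 2 ^ Suc m"
    using ex_power_ivl1[of 2 n] n by auto
  \<comment> \<open>From \<open>n \<ge> 8\<close> follows \<open>m \<ge> 3\<close>, so
    \<open>k = m - 1\<close> is at least 2. Then \<open>2 ^ Suc k \<le> n < 4 * 2 ^ k\<close>, which
    is the source of the constant \<open>1 / 4\<close>.\<close>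
  have "(2::nat) ^ 3 < 2 ^ Suc m"
    using m n by simp
  then have "3 < Suc m"
    by (subst (asm) power_strict_increasing_iff) auto
  then obtain k where k: "m = Suc k" "k \<ge> 2"
    by (cases m) auto
  have low: "2 ^ (2 ^ k) \<le> ?s"
    using ideal_growth_free_semigroup_ge[OF r k(2)] m k by simp
  then have pos: "?s > 0"
    by (rule less_le_trans[rotated]) simp
  have "real n \<le> real (4 * 2 ^ k)"
    using m k by (subst of_nat_le_iff) simp
  then have "real n / 4 \<le> real (2 ^ k)"
    by simp
  also have "\<dots> = log 2 (2 ^ (2 ^ k))"
    by (subst log_nat_power) auto
  also have "\<dots> \<le> log 2 (real ?s)"
    using low pos by (subst log_le_cancel_iff) simp_all
  finally show "real n / 4 \<le> log 2 (real ?s)" .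
  have "?s \<le> 2 ^ Suc (r * Suc n)"
    using ideals_index_upto_free_semigroup[of r n] by (simp add: ideal_growth_eq_card)
  then have "real ?s \<le> real (2 ^ Suc (r * Suc n))"
    by (simp only: of_nat_le_iff)
  then have "log 2 (real ?s) \<le> log 2 (2 ^ Suc (r * Suc n))"
    using pos by simp
  also have "\<dots> = real (Suc (r * Suc n))"
    by (subst log_nat_power) auto
  also have "\<dots> \<le> real ((2 * r + 1) * n)"
  proof (subst of_nat_le_iff)
    have "r \<le> r * n" using n by simp
    then show "Suc (r * Suc n) \<le> (2 * r + 1) * n"
      using n unfolding mult_Suc_right add_mult_distrib mult_1 mult.assoc by linarith
  qed
  finally show "log 2 (real ?s) \<le> real (2 * r + 1) * real n"
    by (simp only: of_nat_mult)
qed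

theorem theorem6p8:
  fixes r :: nat
  assumes "r \<ge> 2"
  shows "ideal_growth_strict_type (free_semigroup r) (@) (\<lambda>n. 2 ^ n) \<and>
         (\<forall>n::nat. n \<ge> 2 \<longrightarrow> (2::real) ^ n = real n powr (real n / log 2 (real n)))"
proof (intro conjI allI impI)
  note bounds = log_ideal_growth_free_semigroup_bounds[OF assms]
  have log: "log 2 ((2::real) ^ n) = real n" for n
    by (subst log_nat_power) auto
  show "ideal_growth_strict_type (free_semigroup r) (@) (\<lambda>n. 2 ^ n)"
    unfolding ideal_growth_strict_type_def log
  proof (rule bigthetaI')
    show "\<forall>\<^sub>F n in sequentially.
        1 / 4 * norm (real n) \<le> norm (log 2 (real (ideal_growth (free_semigroup r) (@) n))) \<and>
        norm (log 2 (real (ideal_growth (free_semigroup r) (@) n)))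
          \<le> real (2 * r + 1) * norm (real n)"
      using eventually_ge_at_top[of 8]
    proof eventually_elim
      case (elim n)
      \<comment> \<open>With the lower bound this makes the logarithm nonnegative, so the norms
        disappear.\<close>
      have "0 \<le> real n / 4" by simp
      with bounds[OF elim] show ?case by simp
    qed
  qed auto
  fix n :: nat assume "n \<ge> 2"
  \<comment> \<open>The exponent is \<open>n * ln 2 / ln n\<close>; a nonzero \<open>ln n\<close>
    cancels against the logarithm of the base.\<close>
  then have "ln (real n) > 0" by simp
  then have "real n powr (real n / log 2 (real n)) = 2 powr real n"
    using \<open>n \<ge> 2\<close> by (simp add: powr_def log_def)
  then show "(2::real) ^ n = real n powr (real n / log 2 (real n))"
    by (simp add: powr_realpow)
qed

end
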